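(* Let $m\le n$, $M\in C(\mathbb{R}^n\to\mathbf{Gl}_n(\mathbb{R}))$, $B\in C(\mathbb{R}^n\to\mathbb{R}^{n\times m})$, $h\in C^1(\mathbb{R}^n\to\mathbb{R}^m)$, and $H(x_1):=h'(x_1)$. Let $U_1\subseteq\mathbb{R}^n$ be open and assume $\Gamma(x_1):=H(x_1)M(x_1)^{-1}B(x_1)\in\mathbf{Gl}_m(\mathbb{R})$ for all $x_1\in U_1$. Then for any $x_1^0\in U_1$ there exist an open neighbourhood $U_1^0\subseteq U_1$ of $x_1^0$ and functions $\phi_1\in C^1(U_1^0\to\mathbb{R}^{n-m})$, $\phi_2\in C(U_1^0\to\mathbb{R}^{(n-m)\times n})$ such that for all $x_1\in U_1^0$ $$\begin{bmatrix}H(x_1)\\ \phi_1'(x_1)\end{bmatrix}\in\mathbf{Gl}_n(\mathbb{R}),\qquad \begin{bmatrix}H(x_1)\\ \phi_2(x_1)\end{bmatrix}\in\mathbf{Gl}_n(\mathbb{R}),\qquad \phi_2(x_1)M(x_1)^{-1}B(x_1)=0.$$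
   Context: $\mathbf{Gl}_k(\mathbb{R})$ is the group of invertible real $k\times k$ matrices; $h'$ and $\phi_1'$ denote Jacobians. These data come from the multibody system $\dot q=v$, $M(q)\dot v=f(q,v)+B(q)u$, $y=h(q)$ with $f\in C(\mathbb{R}^n\times\mathbb{R}^n\to\mathbb{R}^n)$. *)

theory Defs
  imports
    "HOL-Analysis.Abstract_Euclidean_Space"
    "HOL-Analysis.Derivative"
    "HOL-Analysis.L2_Norm"
    "Jordan_Normal_Form.Gauss_Jordan_Elimination"
begin

text \<open>
  The dimensions \<open>n\<close>, \<open>m\<close> and \<open>n - m\<close> (possibly \<open>0\<close>) occur together, so they are natural
  numbers rather than index types. The space \<open>\<real>\<^sup>n\<close> is \<^const>\<open>Euclidean_space\<close>: its points are
  functions \<open>x :: nat \<Rightarrow> real\<close> with \<open>x i = 0\<close> for \<open>i \<ge> n\<close>. Matrices are those of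
  \<^theory>\<open>Jordan_Normal_Form.Matrix\<close>, with indices starting at \<open>0\<close>. Functions given on an open
  set \<open>U\<close> only are total functions whose values outside \<open>U\<close> are irrelevant.
\<close>

definition Gl :: "nat \<Rightarrow> real mat set" where
  "Gl k = {A \<in> carrier_mat k k. invertible_mat A}"

text \<open>
  The library function \<^const>\<open>mat_inverse\<close> returns an option; on \<^const>\<open>Gl\<close> the matrix below is
  the two-sided inverse (see \<open>matinv_Gl\<close>).
\<close>

definition matinv :: "real mat \<Rightarrow> real mat" where
  "matinv A = the (mat_inverse A)"

lemma matinv_Gl:
  assumes "A \<in> Gl k"
  shows "matinv A \<in> carrier_mat k k" "A * matinv A = 1\<^sub>m k" "matinv A * A = 1\<^sub>m k"
proof -
  have A: "A \<in> carrier_mat k k" and "invertible_mat A"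
    using assms by (auto simp: Gl_def)
  then obtain B where AB: "A * B = 1\<^sub>m k" and BA: "B * A = 1\<^sub>m (dim_row B)"
    by (auto simp: invertible_mat_def inverts_mat_def)
  have "dim_col B = k"
    using arg_cong[OF AB, of dim_col] by simp
  moreover have "dim_row B = k"
    using arg_cong[OF BA, of dim_col] A by simp
  ultimately have "A \<in> Units (ring_mat TYPE(real) k ())"
    using A AB BA by (auto simp: Units_def ring_mat_def)
  then obtain C where C: "mat_inverse A = Some C"
    using mat_inverse(1)[OF A, of "()"] by (cases "mat_inverse A") auto
  show "matinv A \<in> carrier_mat k k" "A * matinv A = 1\<^sub>m k" "matinv A * A = 1\<^sub>m k"
    using mat_inverse(2)[OF A C] by (simp_all add: matinv_def C)
qed

text \<open>\<open>A \<in> C(U \<rightarrow> \<real>\<^bsup>k\<times>l\<^esup>)\<close> for \<open>U \<subseteq> \<real>\<^sup>n\<close>, continuity of matrices being entrywise.\<close>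

definition continuous_mat_on ::
    "nat \<Rightarrow> nat \<Rightarrow> nat \<Rightarrow> (nat \<Rightarrow> real) set \<Rightarrow> ((nat \<Rightarrow> real) \<Rightarrow> real mat) \<Rightarrow> bool" where
  "continuous_mat_on n k l U A \<longleftrightarrow>
     (\<forall>x\<in>U. A x \<in> carrier_mat k l) \<and>
     (\<forall>i<k. \<forall>j<l. continuous_map (subtopology (Euclidean_space n) U) euclideanreal
                     (\<lambda>x. A x $$ (i, j)))"

text \<open>The matrix \<open>f'(x)\<close> of partial derivatives of \<open>f\<close>, a map from (a part of) \<open>\<real>\<^sup>n\<close> to \<open>\<real>\<^sup>k\<close>.\<close>

definition jacobian_mat ::
    "nat \<Rightarrow> nat \<Rightarrow> ((nat \<Rightarrow> real) \<Rightarrow> nat \<Rightarrow> real) \<Rightarrow> (nat \<Rightarrow> real) \<Rightarrow> real mat" where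
  "jacobian_mat n k f x = mat k n (\<lambda>(i, j). deriv (\<lambda>t. f (x(j := t)) i) (x j))"

text \<open>
  Total (Frechet) differentiability: \<open>\<parallel>f y - f x - f'(x) (y - x)\<parallel> / \<parallel>y - x\<parallel>\<close> tends to \<open>0\<close>
  as \<open>y\<close> tends to \<open>x\<close> in \<open>\<real>\<^sup>n\<close>.  The value of \<^const>\<open>deriv\<close> is arbitrary where a partial
  derivative does not exist, but the condition can only hold if all of them exist: whichever
  matrix satisfies it consists of the partial derivatives.
\<close>

definition differentiable_at ::
    "nat \<Rightarrow> nat \<Rightarrow> ((nat \<Rightarrow> real) \<Rightarrow> nat \<Rightarrow> real) \<Rightarrow> (nat \<Rightarrow> real) \<Rightarrow> bool" where
  "differentiable_at n k f x \<longleftrightarrow>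
     ((\<lambda>y. L2_set (\<lambda>i. f y i - f x i - (\<Sum>j<n. jacobian_mat n k f x $$ (i, j) * (y j - x j))) {..<k}
           / L2_set (\<lambda>j. y j - x j) {..<n}) \<longlongrightarrow> 0) (atin (Euclidean_space n) x)"

text \<open>\<open>f \<in> C\<^sup>1(U \<rightarrow> \<real>\<^sup>k)\<close> for an open set \<open>U \<subseteq> \<real>\<^sup>n\<close>.\<close>

definition C1_on ::
    "nat \<Rightarrow> nat \<Rightarrow> (nat \<Rightarrow> real) set \<Rightarrow> ((nat \<Rightarrow> real) \<Rightarrow> nat \<Rightarrow> real) \<Rightarrow> bool" where
  "C1_on n k U f \<longleftrightarrow>
     f ` U \<subseteq> topspace (Euclidean_space k) \<and>
     (\<forall>x\<in>U. differentiable_at n k f x) \<and>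
     continuous_mat_on n k n U (jacobian_mat n k f)"

end

theory Submission
  imports Defs "Jordan_Normal_Form.Determinant"
begin

text \<open>This leaves \<bullet> to \<open>scalar_prod\<close> alone.\<close>

unbundle no inner_syntax

text \<open>
  With \<open>R = M\<inverse> B \<Gamma>\<inverse>\<close> we have \<open>H R = 1\<close>, so \<open>H(x0)\<close> has full row rank and its rows can be
  completed by a constant matrix \<open>K\<close> to an invertible one. Invertibility of \<open>[H; K]\<close>, being
  \<open>det \<noteq> 0\<close>, persists near \<open>x0\<close>; there take the linear map \<open>\<phi>1 x = K x\<close> and
  \<open>\<phi>2 = K (1 - R H)\<close>. On the kernel of \<open>H\<close> the matrices \<open>\<phi>2\<close> and \<open>K\<close> agree, so \<open>[H; \<phi>2]\<close> is
  injective too.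
\<close>

section \<open>Matrices\<close>

text \<open>The determinant makes invertibility an open condition on the entries and links it to
  kernels.\<close>

lemma Gl_iff_det:
  assumes A: "A \<in> carrier_mat k k"
  shows "A \<in> Gl k \<longleftrightarrow> det A \<noteq> 0"
proof
  assume "A \<in> Gl k"
  from matinv_Gl[OF this] have "det (A * matinv A) = 1" "matinv A \<in> carrier_mat k k" by auto
  then show "det A \<noteq> 0" using det_mult[OF A, of "matinv A"] by auto
next
  assume "det A \<noteq> 0"
  from det_non_zero_imp_unit[OF A this, of "()"]
  obtain C where "C \<in> carrier_mat k k" "C * A = 1\<^sub>m k" "A * C = 1\<^sub>m k"
    by (auto simp: Units_def ring_mat_def)
  with A show "A \<in> Gl k" by (auto simp: Gl_def invertible_mat_def inverts_mat_def)
qed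

text \<open>Cramer's rule. \<open>mat_inverse\<close> is computed by elimination with case
  distinctions, while this formula is visibly continuous in the entries.\<close>

lemma matinv_eq_adj_mat:
  assumes "A \<in> Gl k"
  shows "matinv A = inverse (det A) \<cdot>\<^sub>m adj_mat A"
proof -
  have A: "A \<in> carrier_mat k k" using assms by (simp add: Gl_def)
  then have "det A \<noteq> 0" using assms Gl_iff_det by blast
  note I = matinv_Gl[OF assms] and adj = adj_mat[OF A]
  \<comment> \<open>The product \<open>matinv A * A * adj_mat A\<close> is bracketed in both
    ways.\<close>
  have "det A \<cdot>\<^sub>m matinv A = matinv A * (det A \<cdot>\<^sub>m 1\<^sub>m k)"
    using I(1) by (simp add: mult_smult_distrib[OF I(1) one_carrier_mat])
  also have "\<dots> = matinv A * A * adj_mat A"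
    using I(1) A adj by (simp add: assoc_mult_mat)
  also have "\<dots> = adj_mat A" using I adj by simp
  finally have "inverse (det A) \<cdot>\<^sub>m (det A \<cdot>\<^sub>m matinv A) = inverse (det A) \<cdot>\<^sub>m adj_mat A" by simp
  moreover have "inverse (det A) \<cdot>\<^sub>m (det A \<cdot>\<^sub>m matinv A) = matinv A"
    using \<open>det A \<noteq> 0\<close> by (intro eq_matI) auto
  ultimately show ?thesis by simp
qed

text \<open>A square matrix is invertible iff its kernel is trivial, and the kernel of a stack is
  the intersection of the kernels of its blocks.\<close>

lemma append_rows_in_Gl_iff:
  assumes A: "A \<in> carrier_mat m n" and K: "K \<in> carrier_mat (n - m) n" and "m \<le> n"
  shows "A @\<^sub>r K \<in> Gl n \<longleftrightarrow>
    (\<forall>v\<in>carrier_vec n. A *\<^sub>v v = 0\<^sub>v m \<longrightarrow> K *\<^sub>v v = 0\<^sub>v (n - m) \<longrightarrow> v = 0\<^sub>v n)"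
proof -
  have C: "A @\<^sub>r K \<in> carrier_mat n n"
    using carrier_append_rows[OF A K] \<open>m \<le> n\<close> by simp
  have "(A @\<^sub>r K) *\<^sub>v v = 0\<^sub>v n \<longleftrightarrow> A *\<^sub>v v = 0\<^sub>v m \<and> K *\<^sub>v v = 0\<^sub>v (n - m)"
    if v: "v \<in> carrier_vec n" for v
  proof -
    have "0\<^sub>v n = 0\<^sub>v m @\<^sub>v (0\<^sub>v (n - m) :: real vec)"
      using \<open>m \<le> n\<close> by (intro eq_vecI) auto
    then show ?thesis
      unfolding mat_mult_append[OF A K v] using A v by (simp add: append_vec_eq[of _ m])
  qed
  then show ?thesis
    unfolding Gl_iff_det[OF C] det_0_iff_vec_prod_zero[OF C] by blast
qed

section \<open>Completing independent rows to an invertible matrix\<close>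

lemma scalar_prod_self_eq_0_iff:
  fixes v :: "real vec"
  assumes "v \<in> carrier_vec n"
  shows "v \<bullet> v = 0 \<longleftrightarrow> v = 0\<^sub>v n"
  using conjugate_square_eq_0_vec[OF assms] by simp

text \<open>Padding \<open>A\<close> with zero rows to a square matrix makes it singular, and the
  zero block puts no constraint on its kernel vectors.\<close>

lemma exists_kernel_vec:
  fixes A :: "real mat"
  assumes A: "A \<in> carrier_mat m n" and "m < n"
  shows "\<exists>w\<in>carrier_vec n. w \<noteq> 0\<^sub>v n \<and> A *\<^sub>v w = 0\<^sub>v m"
proof -
  let ?Z = "0\<^sub>m (n - m) n :: real mat"
  have C: "A @\<^sub>r ?Z \<in> carrier_mat n n"
    using carrier_append_rows[OF A, of ?Z "n - m"] \<open>m < n\<close> by simp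
  \<comment> \<open>As \<open>m < n\<close>, the index \<open>n - 1\<close> lies in the zero block.
    The transpose therefore kills the last unit vector, which gives determinant 0.\<close>
  have "row (A @\<^sub>r ?Z) (n - 1) = 0\<^sub>v n"
    using A \<open>m < n\<close> by (intro eq_vecI) (auto simp: append_rows_def)
  moreover have "(A @\<^sub>r ?Z)\<^sup>T *\<^sub>v unit_vec n (n - 1) = row (A @\<^sub>r ?Z) (n - 1)"
    using C \<open>m < n\<close> by (intro eq_vecI) auto
  ultimately have "(A @\<^sub>r ?Z)\<^sup>T *\<^sub>v unit_vec n (n - 1) = 0\<^sub>v n" by simp
  moreover have "unit_vec n (n - 1) \<noteq> (0\<^sub>v n :: real vec)"
    using \<open>m < n\<close> by simp
  ultimately have "det ((A @\<^sub>r ?Z)\<^sup>T) = 0"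
    using det_0_iff_vec_prod_zero[OF transpose_carrier_mat[THEN iffD2, OF C]] unit_vec_carrier by blast
  then have "A @\<^sub>r ?Z \<notin> Gl n"
    using C Gl_iff_det det_transpose by metis
  then show ?thesis
    using append_rows_in_Gl_iff[OF A, of ?Z] \<open>m < n\<close> by auto
qed

text \<open>The last assumption encodes linear independence of the rows of \<open>A\<close>.\<close>

lemma row_completion:
  fixes A :: "real mat"
  assumes "A \<in> carrier_mat m n" "m \<le> n"
    and "\<And>u. u \<in> carrier_vec m \<Longrightarrow> (\<And>x. x \<in> carrier_vec n \<Longrightarrow> u \<bullet> (A *\<^sub>v x) = 0) \<Longrightarrow> u = 0\<^sub>v m"
  shows "\<exists>K\<in>carrier_mat (n - m) n. A @\<^sub>r K \<in> Gl n"
  using assms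
\<comment> \<open>The induction is on the number of missing rows; each step appends one row to
  \<open>A\<close>.\<close>
proof (induction "n - m" arbitrary: m A)
  case 0
  then have [simp]: "m = n" by simp
  have A: "A \<in> carrier_mat n n" using 0 by simp
  \<comment> \<open>Square case: if the transpose kills \<open>u\<close>, then \<open>u\<close> is
    orthogonal to every \<open>A *\<^sub>v x\<close>, so independence gives \<open>u = 0\<close>.
    The completion then has no rows.\<close>
  have "det (A\<^sup>T) \<noteq> 0"
  proof
    assume "det (A\<^sup>T) = 0"
    then obtain u where u: "u \<in> carrier_vec n" "u \<noteq> 0\<^sub>v n" "A\<^sup>T *\<^sub>v u = 0\<^sub>v n"
      using A det_0_iff_vec_prod_zero[of "A\<^sup>T" n] by auto
    have "u \<bullet> (A *\<^sub>v x) = 0" if "x \<in> carrier_vec n" for x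
      using transpose_vec_mult_scalar[OF A that u(1)] u(3) that by simp
    with 0(4) u show False by auto
  qed
  then have "det A \<noteq> 0" using det_transpose[OF A] by simp
  moreover have "A @\<^sub>r 0\<^sub>m 0 n = A"
    using A by (intro eq_matI) (auto simp: append_rows_def)
  ultimately show ?case
    using A Gl_iff_det by (intro bexI[of _ "0\<^sub>m 0 n"]) auto
next
  case (Suc d)
  note A = Suc.prems(1) and indep = Suc.prems(3)
  have "m < n" using Suc.hyps by simp
  \<comment> \<open>The new row is a kernel vector of \<open>A\<close>: it is orthogonal to all rows
    of \<open>A\<close>, hence independent of them.\<close>
  obtain w where w: "w \<in> carrier_vec n" "w \<noteq> 0\<^sub>v n" "A *\<^sub>v w = 0\<^sub>v m"
    using exists_kernel_vec[OF A \<open>m < n\<close>] by blast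
  have W: "mat_of_row w \<in> carrier_mat 1 n" using w by auto
  have Wv: "mat_of_row w *\<^sub>v x = vec 1 (\<lambda>_. w \<bullet> x)" for x
    by (intro eq_vecI) auto
  let ?A = "A @\<^sub>r mat_of_row w"
  have A': "?A \<in> carrier_mat (m + 1) n" using carrier_append_rows[OF A W] .
  have mult: "?A *\<^sub>v x = (A *\<^sub>v x) @\<^sub>v vec 1 (\<lambda>_. w \<bullet> x)" if "x \<in> carrier_vec n" for x
    using mat_mult_append[OF A W that] Wv by simp
  have indep': "u = 0\<^sub>v (m + 1)"
    if u: "u \<in> carrier_vec (m + 1)"
      and u0: "\<And>x. x \<in> carrier_vec n \<Longrightarrow> u \<bullet> (?A *\<^sub>v x) = 0" for u
  proof -
    define u1 u2 where "u1 = vec_first u m" and "u2 = vec_last u 1"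
    have [simp]: "u1 \<in> carrier_vec m" "u2 \<in> carrier_vec (Suc 0)"
      by (auto simp: u1_def u2_def)
    have u_eq: "u = u1 @\<^sub>v u2"
      using u by (simp add: u1_def u2_def)
    have pair: "u1 \<bullet> (A *\<^sub>v x) + u2 $ 0 * (w \<bullet> x) = 0" if "x \<in> carrier_vec n" for x
      using u0[OF that] that A unfolding mult[OF that] u_eq
      by (subst (asm) scalar_prod_append[of _ m _ 1]) (auto simp: scalar_prod_def)
    \<comment> \<open>At \<open>x = w\<close> the term with \<open>A\<close> vanishes and
      \<open>u2 $ 0 * (w \<bullet> w) = 0\<close> remains. The rest is the independence of the rows
      of \<open>A\<close>.\<close>
    from pair[OF w(1)] have "u2 $ 0 = 0"
      using scalar_prod_self_eq_0_iff[OF w(1)] w by simp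
    moreover from this have "u1 = 0\<^sub>v m"
      using pair indep by auto
    moreover have "u2 = 0\<^sub>v 1"
      using \<open>u2 $ 0 = 0\<close> carrier_vecD[OF \<open>u2 \<in> _\<close>] by (intro eq_vecI) auto
    ultimately show ?thesis
      unfolding u_eq by (intro eq_vecI) auto
  qed
  have "d = n - (m + 1)" "m + 1 \<le> n" using Suc.hyps(2) by simp_all
  from Suc.hyps(1)[OF this(1) A' this(2) indep']
  obtain K where K: "K \<in> carrier_mat (n - (m + 1)) n" "?A @\<^sub>r K \<in> Gl n" by blast
  \<comment> \<open>The row \<open>w\<close> moves from the upper block to the lower one. Both
    bracketings impose the same equations on a kernel vector, so the kernel criterion carries
    invertibility over.\<close>
  let ?K = "mat_of_row w @\<^sub>r K"
  have K': "?K \<in> carrier_mat (n - m) n"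
    using carrier_append_rows[OF W K(1)] \<open>m < n\<close> by (simp add: Suc_diff_Suc)
  have "v = 0\<^sub>v n"
    if v: "v \<in> carrier_vec n" "A *\<^sub>v v = 0\<^sub>v m" "?K *\<^sub>v v = 0\<^sub>v (n - m)" for v
  proof -
    have "0\<^sub>v (n - m) = 0\<^sub>v 1 @\<^sub>v (0\<^sub>v (n - (m + 1)) :: real vec)"
      using \<open>m < n\<close> by (intro eq_vecI) auto
    with v have "vec 1 (\<lambda>_. w \<bullet> v) = 0\<^sub>v 1" "K *\<^sub>v v = 0\<^sub>v (n - (m + 1))"
      using mat_mult_append[OF W K(1) v(1)] Wv by (auto simp: append_vec_eq[of _ 1])
    moreover have "0\<^sub>v m @\<^sub>v 0\<^sub>v 1 = (0\<^sub>v (m + 1) :: real vec)"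
      by (intro eq_vecI) auto
    ultimately show ?thesis
      using append_rows_in_Gl_iff[OF A' K(1)] K(2) v mult[OF v(1)] \<open>m < n\<close> by simp
  qed
  then show ?case
    using append_rows_in_Gl_iff[OF A K'] K' \<open>m < n\<close> by auto
qed

text \<open>A right inverse forces independent rows: if \<open>u\<close> is orthogonal to the range
  of \<open>A\<close>, testing with \<open>R *\<^sub>v u\<close> gives
  \<open>u \<bullet> u = 0\<close>.\<close>

lemma row_completion_right_inverse:
  fixes A :: "real mat"
  assumes A: "A \<in> carrier_mat m n" and R: "R \<in> carrier_mat n m"
    and AR: "A * R = 1\<^sub>m m" and "m \<le> n"
  shows "\<exists>K\<in>carrier_mat (n - m) n. A @\<^sub>r K \<in> Gl n"
proof (rule row_completion[OF A \<open>m \<le> n\<close>])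
  fix u assume u: "u \<in> carrier_vec m"
    and "\<And>x. x \<in> carrier_vec n \<Longrightarrow> u \<bullet> (A *\<^sub>v x) = 0"
  then have "u \<bullet> (A *\<^sub>v (R *\<^sub>v u)) = 0" using R by auto
  then have "u \<bullet> u = 0"
    using u AR by (simp add: assoc_mult_mat_vec[OF A R u, symmetric])
  then show "u = 0\<^sub>v m" using scalar_prod_self_eq_0_iff[OF u] by simp
qed

text \<open>Subtracting combinations of the rows of \<open>A\<close> from \<open>K\<close> leaves
  the action of \<open>K\<close> on the kernel of \<open>A\<close> unchanged.\<close>

lemma append_rows_project_in_Gl:
  assumes A: "A \<in> carrier_mat m n" and K: "K \<in> carrier_mat (n - m) n" and "m \<le> n"
    and S: "S \<in> carrier_mat (n - m) m" and G: "A @\<^sub>r K \<in> Gl n"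
  shows "A @\<^sub>r (K - S * A) \<in> Gl n"
proof -
  have KS: "K - S * A \<in> carrier_mat (n - m) n" using K S A by auto
  have "K *\<^sub>v v = 0\<^sub>v (n - m)"
    if v: "v \<in> carrier_vec n" "A *\<^sub>v v = 0\<^sub>v m" "(K - S * A) *\<^sub>v v = 0\<^sub>v (n - m)" for v
  proof -
    have "(K - S * A) *\<^sub>v v = K *\<^sub>v v - S *\<^sub>v (A *\<^sub>v v)"
      using K S A v(1) by (simp add: minus_mult_distrib_mat_vec[of _ "n - m" n])
    also have "\<dots> = K *\<^sub>v v"
      using K S v by (auto simp: minus_zero_vec)
    finally show ?thesis using v(3) by simp
  qed
  then show ?thesis
    using G unfolding append_rows_in_Gl_iff[OF A K \<open>m \<le> n\<close>] append_rows_in_Gl_iff[OF A KS \<open>m \<le> n\<close>]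
    by blast
qed

section \<open>Continuity of matrix operations\<close>

lemma continuous_mat_on_subset:
  assumes "continuous_mat_on n k l U A" "V \<subseteq> U"
  shows "continuous_mat_on n k l V A"
  using assms unfolding continuous_mat_on_def
  by (meson continuous_map_from_subtopology_mono subsetD)

text \<open>Used below to replace a matrix expression by the matrix of its entry formulas, whose
  continuity is a statement about real functions.\<close>

lemma continuous_mat_on_cong:
  assumes "\<And>x. x \<in> U \<Longrightarrow> A x = A' x" "continuous_mat_on n k l U A"
  shows "continuous_mat_on n k l U A'"
  unfolding continuous_mat_on_def
proof (intro conjI ballI allI impI)
  show "A' x \<in> carrier_mat k l" if "x \<in> U" for x
    using assms that by (auto simp: continuous_mat_on_def)
  fix i j assume "i < k" "j < l"
  with assms(2) have "continuous_map (subtopology (Euclidean_space n) U) euclideanreal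
      (\<lambda>x. A x $$ (i, j))"
    by (simp add: continuous_mat_on_def)
  then show "continuous_map (subtopology (Euclidean_space n) U) euclideanreal
      (\<lambda>x. A' x $$ (i, j))"
    by (rule continuous_map_eq) (simp add: assms(1))
qed

lemma continuous_mat_on_const:
  "K \<in> carrier_mat k l \<Longrightarrow> continuous_mat_on n k l U (\<lambda>_. K)"
  by (simp add: continuous_mat_on_def)

lemma continuous_mat_on_mat:
  assumes "\<And>i j. i < k \<Longrightarrow> j < l \<Longrightarrow>
    continuous_map (subtopology (Euclidean_space n) U) euclideanreal (\<lambda>x. f x i j)"
  shows "continuous_mat_on n k l U (\<lambda>x. mat k l (\<lambda>(i, j). f x i j))"
  using assms by (simp add: continuous_mat_on_def)

lemma continuous_mat_on_entry:
  assumes "continuous_mat_on n k l U A" "i < k" "j < l"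
  shows "continuous_map (subtopology (Euclidean_space n) U) euclideanreal (\<lambda>x. A x $$ (i, j))"
  using assms by (simp add: continuous_mat_on_def)

lemma continuous_mat_on_minus:
  assumes A: "continuous_mat_on n k l U A" and A': "continuous_mat_on n k l U A'"
  shows "continuous_mat_on n k l U (\<lambda>x. A x - A' x)"
proof (rule continuous_mat_on_cong)
  show "continuous_mat_on n k l U (\<lambda>x. mat k l (\<lambda>(i, j). A x $$ (i, j) - A' x $$ (i, j)))"
    by (intro continuous_mat_on_mat continuous_map_diff continuous_mat_on_entry[OF A]
        continuous_mat_on_entry[OF A'])
qed (use A A' in \<open>auto simp: continuous_mat_on_def intro!: eq_matI\<close>)

lemma continuous_mat_on_mult:
  assumes A: "continuous_mat_on n k l U A" and A': "continuous_mat_on n l p U A'"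
  shows "continuous_mat_on n k p U (\<lambda>x. A x * A' x)"
proof (rule continuous_mat_on_cong)
  show "continuous_mat_on n k p U
    (\<lambda>x. mat k p (\<lambda>(i, j). \<Sum>r = 0..<l. A x $$ (i, r) * A' x $$ (r, j)))"
    by (intro continuous_mat_on_mat continuous_map_sum continuous_map_real_mult
        continuous_mat_on_entry[OF A] continuous_mat_on_entry[OF A']) auto
  fix x assume "x \<in> U"
  with A A' have "A x \<in> carrier_mat k l" "A' x \<in> carrier_mat l p"
    by (auto simp: continuous_mat_on_def)
  then show "mat k p (\<lambda>(i, j). \<Sum>r = 0..<l. A x $$ (i, r) * A' x $$ (r, j)) = A x * A' x"
    by (intro eq_matI) (auto simp: scalar_prod_def intro!: sum.cong)
qed

lemma continuous_mat_on_append_rows: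
  assumes A: "continuous_mat_on n k l U A" and A': "continuous_mat_on n k' l U A'"
  shows "continuous_mat_on n (k + k') l U (\<lambda>x. A x @\<^sub>r A' x)"
proof (rule continuous_mat_on_cong)
  show "continuous_mat_on n (k + k') l U
    (\<lambda>x. mat (k + k') l (\<lambda>(i, j). if i < k then A x $$ (i, j) else A' x $$ (i - k, j)))"
  proof (rule continuous_mat_on_mat)
    fix i j assume "i < k + k'" "j < l"
    then show "continuous_map (subtopology (Euclidean_space n) U) euclideanreal
      (\<lambda>x. if i < k then A x $$ (i, j) else A' x $$ (i - k, j))"
      using continuous_mat_on_entry[OF A] continuous_mat_on_entry[OF A'] by (cases "i < k") auto
  qed
  fix x assume "x \<in> U"
  with A A' have "A x \<in> carrier_mat k l" "A' x \<in> carrier_mat k' l"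
    by (auto simp: continuous_mat_on_def)
  then show "mat (k + k') l (\<lambda>(i, j). if i < k then A x $$ (i, j) else A' x $$ (i - k, j))
      = A x @\<^sub>r A' x"
    by (intro eq_matI) (auto simp: append_rows_def)
qed

lemma continuous_map_det:
  assumes A: "continuous_mat_on n k k U A"
  shows "continuous_map (subtopology (Euclidean_space n) U) euclideanreal (\<lambda>x. det (A x))"
proof (rule continuous_map_eq)
  \<comment> \<open>The Leibniz formula is a polynomial in the entries.\<close>
  show "continuous_map (subtopology (Euclidean_space n) U) euclideanreal
    (\<lambda>x. \<Sum>p | p permutes {0..<k}. signof p * (\<Prod>i = 0..<k. A x $$ (i, p i)))"
  proof (intro continuous_map_sum continuous_map_real_mult continuous_map_prod
      continuous_mat_on_entry[OF A])
    fix p i assume "p \<in> {p. p permutes {0..<k}}" "i \<in> {0..<k}"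
    then show "p i < k" using permutes_in_image[of p "{0..<k}" i] by simp
  qed (auto simp: finite_permutations)
qed (use A in \<open>auto simp: continuous_mat_on_def det_def\<close>)

lemma continuous_mat_on_adj_mat:
  assumes A: "continuous_mat_on n k k U A"
  shows "continuous_mat_on n k k U (\<lambda>x. adj_mat (A x))"
proof (rule continuous_mat_on_cong)
  let ?i = "insert_index"
  \<comment> \<open>The entries of a minor are entries of \<open>A x\<close> at indices that skip
    the deleted row and column. The order \<open>j i\<close> reflects the transposition in the
    adjugate.\<close>
  have "continuous_mat_on n (k - 1) (k - 1) U (\<lambda>x. mat_delete (A x) j i)"
    if "i < k" "j < k" for i j
  proof (rule continuous_mat_on_cong)
    show "continuous_mat_on n (k - 1) (k - 1) U
      (\<lambda>x. mat (k - 1) (k - 1) (\<lambda>(i', j'). A x $$ (?i j i', ?i i j')))"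
      using that
      by (intro continuous_mat_on_mat continuous_mat_on_entry[OF A]) (auto simp: insert_index_def)
  qed (use A in \<open>auto simp: continuous_mat_on_def mat_delete_def insert_index_def
        intro!: eq_matI\<close>)
  then show "continuous_mat_on n k k U (\<lambda>x. mat k k (\<lambda>(i, j). cofactor (A x) j i))"
    unfolding cofactor_def
    by (intro continuous_mat_on_mat continuous_map_real_mult continuous_map_det) auto
qed (use A in \<open>auto simp: continuous_mat_on_def adj_mat_def\<close>)

lemma continuous_mat_on_matinv:
  assumes A: "continuous_mat_on n k k U A" and Gl: "\<And>x. x \<in> U \<Longrightarrow> A x \<in> Gl k"
  shows "continuous_mat_on n k k U (\<lambda>x. matinv (A x))"
proof (rule continuous_mat_on_cong)
  have "det (A x) \<noteq> 0" if "x \<in> U" for x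
    using Gl[OF that] Gl_iff_det[of "A x" k] by (auto simp: Gl_def)
  then show "continuous_mat_on n k k U
    (\<lambda>x. mat k k (\<lambda>(i, j). inverse (det (A x)) * adj_mat (A x) $$ (i, j)))"
    by (intro continuous_mat_on_mat continuous_map_real_mult continuous_map_real_inverse
        continuous_map_det[OF A] continuous_mat_on_entry[OF continuous_mat_on_adj_mat[OF A]]) auto
  fix x assume "x \<in> U"
  then show "mat k k (\<lambda>(i, j). inverse (det (A x)) * adj_mat (A x) $$ (i, j)) = matinv (A x)"
    using matinv_eq_adj_mat[OF Gl] adj_mat(1)[of "A x" k] A
    by (auto simp: continuous_mat_on_def intro!: eq_matI)
qed

section \<open>Linear maps\<close>

text \<open>The value 0 from index \<open>dim_row K\<close> on makes the result a point of the
  Euclidean space of that dimension.\<close>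

definition linear_fun :: "real mat \<Rightarrow> (nat \<Rightarrow> real) \<Rightarrow> nat \<Rightarrow> real" where
  "linear_fun K x i = (if i < dim_row K then \<Sum>j<dim_col K. K $$ (i, j) * x j else 0)"

lemma jacobian_mat_linear_fun:
  assumes K: "K \<in> carrier_mat k n"
  shows "jacobian_mat n k (linear_fun K) x = K"
proof -
  have "deriv (\<lambda>t. linear_fun K (x(j := t)) i) (x j) = K $$ (i, j)" if "i < k" "j < n" for i j
  proof (rule DERIV_imp_deriv)
    \<comment> \<open>In its \<open>j\<close>-th coordinate alone the map is affine with slope
      \<open>K $$ (i, j)\<close>.\<close>
    have "(\<lambda>t. linear_fun K (x(j := t)) i)
        = (\<lambda>t. K $$ (i, j) * t + (\<Sum>l\<in>{..<n} - {j}. K $$ (i, l) * x l))"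
      using K that by (auto simp: linear_fun_def sum.remove[of "{..<n}" j] fun_eq_iff)
    then show "((\<lambda>t. linear_fun K (x(j := t)) i) has_field_derivative K $$ (i, j)) (at (x j))"
      by (auto intro!: derivative_eq_intros)
  qed
  then show ?thesis
    using K by (auto simp: jacobian_mat_def intro!: eq_matI)
qed

lemma C1_on_linear_fun:
  assumes K: "K \<in> carrier_mat k n"
  shows "C1_on n k U (linear_fun K)"
  unfolding C1_on_def
proof (intro conjI ballI)
  show "linear_fun K ` U \<subseteq> topspace (Euclidean_space k)"
    using K by (auto simp: topspace_Euclidean_space linear_fun_def)
  show "continuous_mat_on n k n U (jacobian_mat n k (linear_fun K))"
    using continuous_mat_on_const[OF K]
    by (simp add: jacobian_mat_linear_fun[OF K] continuous_mat_on_def)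
  fix x assume "x \<in> U"
  \<comment> \<open>The remainder vanishes identically, so the difference quotient is constantly
    0.\<close>
  have "linear_fun K y i - linear_fun K x i - (\<Sum>j<n. K $$ (i, j) * (y j - x j)) = 0"
    if "i < k" for y i
    using K that by (simp add: linear_fun_def right_diff_distrib sum_subtractf)
  then show "differentiable_at n k (linear_fun K) x"
    unfolding differentiable_at_def jacobian_mat_linear_fun[OF K] by (simp add: L2_set_def)
qed

section \<open>Local completion of the output Jacobian\<close>

theorem lemma3p1:
  fixes n m :: nat
    and M B :: "(nat \<Rightarrow> real) \<Rightarrow> real mat"
    and h :: "(nat \<Rightarrow> real) \<Rightarrow> nat \<Rightarrow> real"
    and H \<Gamma> :: "(nat \<Rightarrow> real) \<Rightarrow> real mat"
    and U1 :: "(nat \<Rightarrow> real) set"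
    and x0 :: "nat \<Rightarrow> real"
  assumes "m \<le> n"
    and "continuous_mat_on n n n (topspace (Euclidean_space n)) M"
    and "\<And>x. x \<in> topspace (Euclidean_space n) \<Longrightarrow> M x \<in> Gl n"
    and "continuous_mat_on n n m (topspace (Euclidean_space n)) B"
    and "C1_on n m (topspace (Euclidean_space n)) h"
    and "\<And>x. x \<in> topspace (Euclidean_space n) \<Longrightarrow> H x = jacobian_mat n m h x"
    and "openin (Euclidean_space n) U1"
    and "\<And>x. x \<in> U1 \<Longrightarrow> \<Gamma> x = H x * matinv (M x) * B x"
    and "\<And>x. x \<in> U1 \<Longrightarrow> \<Gamma> x \<in> Gl m"
    and "x0 \<in> U1"
  shows "\<exists>U0 \<phi>1 \<phi>2.
    openin (Euclidean_space n) U0 \<and> x0 \<in> U0 \<and> U0 \<subseteq> U1 \<and>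
    C1_on n (n - m) U0 \<phi>1 \<and>
    continuous_mat_on n (n - m) n U0 \<phi>2 \<and>
    (\<forall>x\<in>U0. H x @\<^sub>r jacobian_mat n (n - m) \<phi>1 x \<in> Gl n \<and>
             H x @\<^sub>r \<phi>2 x \<in> Gl n \<and>
             \<phi>2 x * matinv (M x) * B x = 0\<^sub>m (n - m) m)"
proof -
  let ?E = "Euclidean_space n"
  have U1: "U1 \<subseteq> topspace ?E" using assms(7) by (rule openin_subset)
  have cM: "continuous_mat_on n n n U1 M" and cB: "continuous_mat_on n n m U1 B"
    using assms(2,4) U1 continuous_mat_on_subset by blast+
  have "continuous_mat_on n m n U1 (jacobian_mat n m h)"
    using assms(5) U1 by (meson C1_on_def continuous_mat_on_subset)
  then have cH: "continuous_mat_on n m n U1 H"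
    by (rule continuous_mat_on_cong[rotated]) (use U1 assms(6) in auto)
  \<comment> \<open>\<open>N\<close> is the common factor in \<open>\<Gamma> = H N\<close> and in
    the required identity \<open>\<phi>2 N = 0\<close>.\<close>
  define N where "N x = matinv (M x) * B x" for x
  have cN: "continuous_mat_on n n m U1 N"
    unfolding N_def using U1 assms(3)
    by (intro continuous_mat_on_mult[OF _ cB] continuous_mat_on_matinv[OF cM]) auto
  have carrier: "H x \<in> carrier_mat m n" "N x \<in> carrier_mat n m"
    "matinv (M x) \<in> carrier_mat n n" "B x \<in> carrier_mat n m" if "x \<in> U1" for x
    using that cH cN cB matinv_Gl(1)[OF assms(3)] U1 by (auto simp: continuous_mat_on_def)
  have \<Gamma>: "\<Gamma> x = H x * N x" if "x \<in> U1" for x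
    using assms(8)[OF that] carrier[OF that] by (simp add: N_def assoc_mult_mat[of _ m n _ n _ m])
  have c\<Gamma>: "continuous_mat_on n m m U1 \<Gamma>"
    by (rule continuous_mat_on_cong[OF _ continuous_mat_on_mult[OF cH cN]]) (simp add: \<Gamma>)
  note I = matinv_Gl[OF assms(9)]
  note c0 = carrier[OF assms(10)] I[OF assms(10)]
  \<comment> \<open>Invertibility of \<open>\<Gamma> x0 = H x0 * N x0\<close> supplies a right
    inverse of \<open>H x0\<close>.\<close>
  have "H x0 * (N x0 * matinv (\<Gamma> x0)) = H x0 * N x0 * matinv (\<Gamma> x0)"
    by (rule assoc_mult_mat[symmetric]) (fact c0)+
  also have "\<dots> = 1\<^sub>m m"
    using c0(6) by (simp only: \<Gamma>[OF assms(10)])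
  finally have "H x0 * (N x0 * matinv (\<Gamma> x0)) = 1\<^sub>m m" .
  then obtain K where K: "K \<in> carrier_mat (n - m) n" "H x0 @\<^sub>r K \<in> Gl n"
    using row_completion_right_inverse[of "H x0" m n "N x0 * matinv (\<Gamma> x0)"]
      c0 assms(1) by auto

  \<comment> \<open>\<open>U0\<close> is the part of \<open>U1\<close> where the constant
    \<open>K\<close> still completes \<open>H x\<close>; it is open as the preimage of the nonzero
    reals under a continuous determinant.\<close>
  define U0 where "U0 = {x \<in> U1. H x @\<^sub>r K \<in> Gl n}"
  have cHK: "continuous_mat_on n n n U1 (\<lambda>x. H x @\<^sub>r K)"
    using continuous_mat_on_append_rows[OF cH continuous_mat_on_const[OF K(1)]] assms(1) by simp
  then have "H x @\<^sub>r K \<in> carrier_mat n n" if "x \<in> U1" for x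
    using that by (simp add: continuous_mat_on_def)
  then have "U0 = {x \<in> topspace (subtopology ?E U1). det (H x @\<^sub>r K) \<in> - {0}}"
    using U1 by (auto simp: U0_def Gl_iff_det)
  moreover have "openin (subtopology ?E U1) {x \<in> topspace (subtopology ?E U1). det (H x @\<^sub>r K) \<in> - {0}}"
    by (rule openin_continuous_map_preimage[OF continuous_map_det[OF cHK]]) auto
  ultimately have "openin ?E U0"
    using assms(7) openin_trans_full by metis
  have "U0 \<subseteq> U1" "x0 \<in> U0"
    using K(2) assms(10) by (auto simp: U0_def)

  \<comment> \<open>\<open>S\<close> is chosen so that \<open>S H N = K N\<close>; thus
    \<open>\<phi>2\<close> is \<open>K\<close> corrected to annihilate \<open>N\<close>, with only
    multiples of the rows of \<open>H\<close> subtracted.\<close>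
  define S where "S x = K * N x * matinv (\<Gamma> x)" for x
  define \<phi>2 where "\<phi>2 x = K - S x * H x" for x
  have cS: "continuous_mat_on n (n - m) m U1 S"
    unfolding S_def using assms(9)
    by (intro continuous_mat_on_mult[OF continuous_mat_on_mult[OF continuous_mat_on_const[OF K(1)] cN]]
        continuous_mat_on_matinv[OF c\<Gamma>])
  have "continuous_mat_on n (n - m) n U1 \<phi>2"
    unfolding \<phi>2_def
    by (intro continuous_mat_on_minus continuous_mat_on_const[OF K(1)] continuous_mat_on_mult[OF cS cH])
  then have c\<phi>2: "continuous_mat_on n (n - m) n U0 \<phi>2"
    using \<open>U0 \<subseteq> U1\<close> by (rule continuous_mat_on_subset)
  have "H x @\<^sub>r \<phi>2 x \<in> Gl n \<and> \<phi>2 x * matinv (M x) * B x = 0\<^sub>m (n - m) m" if "x \<in> U0" for x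
  proof
    have x: "x \<in> U1" using that \<open>U0 \<subseteq> U1\<close> by blast
    note c = carrier[OF x] I[OF x]
    have S: "S x \<in> carrier_mat (n - m) m"
      using cS x by (simp add: continuous_mat_on_def)
    show "H x @\<^sub>r \<phi>2 x \<in> Gl n"
      unfolding \<phi>2_def using that
      by (intro append_rows_project_in_Gl[OF c(1) K(1) assms(1) S]) (simp add: U0_def)
    have "\<phi>2 x * matinv (M x) * B x = \<phi>2 x * N x"
      unfolding N_def using c S K(1)
      by (intro assoc_mult_mat[of _ "n - m" n _ n _ m]) (auto simp: \<phi>2_def)
    also have "\<dots> = K * N x - S x * (H x * N x)"
      unfolding \<phi>2_def using c S K(1)
      by (simp add: minus_mult_distrib_mat[of _ "n - m" n] assoc_mult_mat[of _ "n - m" m _ n _ m])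
    \<comment> \<open>Here \<open>H x * N x\<close> is \<open>\<Gamma> x\<close>, which cancels
      against the inverse inside \<open>S x\<close>.\<close>
    also have "S x * (H x * N x) = K * N x * (matinv (\<Gamma> x) * \<Gamma> x)"
      unfolding S_def \<Gamma>[OF x, symmetric] using c K(1) \<Gamma>[OF x]
      by (intro assoc_mult_mat[of _ "n - m" m _ m _ m]) auto
    also have "\<dots> = K * N x"
      using c K(1) by simp
    also have "K * N x - K * N x = 0\<^sub>m (n - m) m"
      using c K(1) by (intro eq_matI) auto
    finally show "\<phi>2 x * matinv (M x) * B x = 0\<^sub>m (n - m) m" .
  qed
  \<comment> \<open>With \<open>\<phi>1 = linear_fun K\<close> the Jacobian is \<open>K\<close> at
    every point, so this is the defining condition of \<open>U0\<close>.\<close>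
  moreover have "H x @\<^sub>r jacobian_mat n (n - m) (linear_fun K) x \<in> Gl n" if "x \<in> U0" for x
    using that by (simp add: jacobian_mat_linear_fun[OF K(1)] U0_def)
  ultimately show ?thesis
    using \<open>openin ?E U0\<close> \<open>x0 \<in> U0\<close> \<open>U0 \<subseteq> U1\<close> c\<phi>2 C1_on_linear_fun[OF K(1)] by blast
qed

end
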